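(* Every Neumann subgroup of $\widehat{\mathcal M}=PGL(2,\mathbb Z)$ is a maximal anisotropy subgroup of $\widehat{\mathcal M}$; that is, it is an anisotropy subgroup and is not properly contained in any anisotropy subgroup of $\widehat{\mathcal M}$.
   Context: $\widehat{\mathcal M}=PGL(2,\mathbb Z)$ acts on $\mathbb Q^*=\mathbb Q\cup\{\infty\}$ by fractional linear transformations. An isotropy subgroup of $\widehat{\mathcal M}$ is the stabilizer $\widehat{\mathcal M}_{(p)}$ of some $p\in\mathbb Q^*$. With $\tau=\pm\begin{pmatrix}1&1\\0&1\end{pmatrix}$ and $\nu=\pm\begin{pmatrix}-1&0\\0&1\end{pmatrix}$, the stabilizer of $\infty$ is $\widehat{\mathcal T}=\{\tau^n\nu^\epsilon:n\in\mathbb Z,\ \epsilon\in\{0,1\}\}$, and the isotropy subgroups are exactly the conjugates of $\widehat{\mathcal T}$. A Neumann subgroup of $\widehat{\mathcal M}$ is a subgroup $\widehat{\mathcal S}$ with $\widehat{\mathcal S}\,\widehat{\mathcal T}=\widehat{\mathcal M}$ and $\widehat{\mathcal S}\cap\widehat{\mathcal T}=1$. A subgroup of $\widehat{\mathcal M}$ is an anisotropy subgroup if it contains no element of any isotropy subgroup except the identity. *)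

theory Defs
  imports "HOL-Analysis.Determinants" "HOL-Algebra.Group_Action"
begin

definition GL2Z :: "(int^2^2) monoid" where
  "GL2Z = \<lparr>carrier = {A. invertible A}, mult = (**), one = mat 1\<rparr>"

text \<open>The scalar matrices in \<open>GL(2,\<int>)\<close> are \<open>\<plusminus>I\<close>, so an element of \<open>PGL(2,\<int>)\<close> is a two-element
  coset \<open>{A, -A}\<close>; see \<open>carrier_PGL2Z\<close> and \<open>mult_PGL2Z\<close> below.\<close>

definition PGL2Z :: "(int^2^2) set monoid" where
  "PGL2Z = GL2Z Mod {mat 1, - mat 1}"

definition pm :: "int^2^2 \<Rightarrow> (int^2^2) set" where
  "pm A = {A, - A}"

text \<open>\<open>\<rat> \<union> {\<infinity>}\<close> is modelled by \<^typ>\<open>rat option\<close>, where \<^const>\<open>None\<close> is the point at infinity.\<close>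

definition moebius :: "int^2^2 \<Rightarrow> rat option \<Rightarrow> rat option" where
  "moebius A p =
    (let a = of_int (A$1$1); b = of_int (A$1$2); c = of_int (A$2$1); d = of_int (A$2$2) in
     case p of
       None \<Rightarrow> if c = 0 then None else Some (a / c)
     | Some x \<Rightarrow> if c * x + d = 0 then None else Some ((a * x + b) / (c * x + d)))"

text \<open>Both representatives of an element of \<open>PGL(2,\<int>)\<close> induce the same map, so the set below is a
  singleton (\<open>pgl_action_pm\<close>).\<close>

definition pgl_action :: "(int^2^2) set \<Rightarrow> rat option \<Rightarrow> rat option" where
  "pgl_action X p = the_elem ((\<lambda>A. moebius A p) ` X)"

abbreviation pgl_stabilizer :: "rat option \<Rightarrow> (int^2^2) set set" where
  "pgl_stabilizer \<equiv> stabilizer PGL2Z pgl_action"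

definition tau :: "(int^2^2) set" where
  "tau = pm (vector [vector [1, 1], vector [0, 1]])"

definition nu :: "(int^2^2) set" where
  "nu = pm (vector [vector [-1, 0], vector [0, 1]])"

text \<open>This is the stabilizer of infinity, see \<open>T_hat_eq_stabilizer\<close>.\<close>

definition T_hat :: "(int^2^2) set set" where
  "T_hat = {tau [^]\<^bsub>PGL2Z\<^esub> n \<otimes>\<^bsub>PGL2Z\<^esub> nu [^]\<^bsub>PGL2Z\<^esub> e | (n::int) (e::nat). e \<in> {0, 1}}"

definition isotropy_subgroup :: "(int^2^2) set set \<Rightarrow> bool" where
  "isotropy_subgroup H \<longleftrightarrow> (\<exists>p. H = pgl_stabilizer p)"

definition anisotropy_subgroup :: "(int^2^2) set set \<Rightarrow> bool" where
  "anisotropy_subgroup S \<longleftrightarrow> subgroup S PGL2Z \<and>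
     (\<forall>H. isotropy_subgroup H \<longrightarrow> (\<forall>g \<in> S \<inter> H. g = \<one>\<^bsub>PGL2Z\<^esub>))"

definition maximal_anisotropy_subgroup :: "(int^2^2) set set \<Rightarrow> bool" where
  "maximal_anisotropy_subgroup S \<longleftrightarrow> anisotropy_subgroup S \<and>
     \<not> (\<exists>S'. anisotropy_subgroup S' \<and> S \<subset> S')"

definition neumann_subgroup :: "(int^2^2) set set \<Rightarrow> bool" where
  "neumann_subgroup S \<longleftrightarrow> subgroup S PGL2Z \<and>
     S <#>\<^bsub>PGL2Z\<^esub> T_hat = carrier PGL2Z \<and> S \<inter> T_hat = {\<one>\<^bsub>PGL2Z\<^esub>}"

lemma GL2Z_sel [simp]:
  "carrier GL2Z = {A. invertible A}" "mult GL2Z = (**)" "one GL2Z = mat 1"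
  by (simp_all add: GL2Z_def)

lemma neg_mult_2:
  fixes A B :: "int^2^2"
  shows "(- A) ** B = - (A ** B)" "A ** (- B) = - (A ** B)"
  by (simp_all add: matrix_matrix_mult_def vec_eq_iff sum_negf)

lemma invertible_uminus: "invertible (A :: int^2^2) \<Longrightarrow> invertible (- A)"
  unfolding invertible_def by (metis neg_mult_2 minus_minus)

lemma group_GL2Z: "Group.group GL2Z"
proof (rule groupI)
  fix x assume "x \<in> carrier GL2Z"
  then show "\<exists>y\<in>carrier GL2Z. y \<otimes>\<^bsub>GL2Z\<^esub> x = \<one>\<^bsub>GL2Z\<^esub>"
    by (auto simp: invertible_def)
qed (auto simp: matrix_mul_assoc invertible_mult, auto simp: invertible_def)

lemma normal_GL2Z: "{mat 1, - mat 1} \<lhd> GL2Z"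
proof -
  interpret Group.group GL2Z by (rule group_GL2Z)
  have I: "invertible (mat 1 :: int^2^2)" using one_closed by simp
  have "subgroup {mat 1, - mat 1} GL2Z"
  proof (rule subgroupI)
    fix a :: "int^2^2" assume "a \<in> {mat 1, - mat 1}"
    then have "inv\<^bsub>GL2Z\<^esub> a = a"
      using I by (intro inv_equality) (auto simp: neg_mult_2 invertible_uminus)
    then show "inv\<^bsub>GL2Z\<^esub> a \<in> {mat 1, - mat 1}"
      using \<open>a \<in> _\<close> by simp
  qed (use I in \<open>auto simp: neg_mult_2 invertible_uminus\<close>)
  then show ?thesis
    by (rule normalI) (auto simp: r_coset_def l_coset_def neg_mult_2)
qed

lemma group_PGL2Z: "Group.group PGL2Z"
  unfolding PGL2Z_def by (rule normal.factorgroup_is_group[OF normal_GL2Z])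

lemma carrier_PGL2Z: "carrier PGL2Z = pm ` {A. invertible A}"
  by (auto simp: PGL2Z_def carrier_FactGroup r_coset_def pm_def neg_mult_2)

lemma one_PGL2Z: "\<one>\<^bsub>PGL2Z\<^esub> = pm (mat 1)"
  by (simp add: PGL2Z_def pm_def)

lemma mult_PGL2Z: "pm A \<otimes>\<^bsub>PGL2Z\<^esub> pm B = pm (A ** B)"
  by (auto simp: PGL2Z_def set_mult_def pm_def neg_mult_2)

lemma moebius_uminus: "moebius (- A) p = moebius A p"
proof (cases p)
  case (Some x)
  have "- (of_int (A$2$1) * x) - of_int (A$2$2) = - (of_int (A$2$1) * x + of_int (A$2$2))"
       "- (of_int (A$1$1) * x) - of_int (A$1$2) = - (of_int (A$1$1) * x + of_int (A$1$2))"
    by simp_all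
  then show ?thesis
    unfolding moebius_def Let_def Some
    by (simp only: option.case vector_uminus_component of_int_minus mult_minus_left
        diff_conv_add_uminus[symmetric] neg_equal_0_iff_equal minus_divide_divide)
qed (simp add: moebius_def)

lemma pgl_action_pm: "pgl_action (pm A) p = moebius A p"
  by (simp add: pgl_action_def pm_def moebius_uminus)

lemma invertible_det_2:
  fixes A :: "int^2^2"
  assumes "invertible A"
  shows "A$1$1 * A$2$2 - A$1$2 * A$2$1 \<in> {1, -1}"
proof -
  obtain B where "A ** B = mat 1"
    using assms by (auto simp: invertible_def)
  then have "det A * det B = 1"
    by (metis det_mul det_I)
  then have "det A \<in> {1, -1}"
    using zmult_eq_1_iff by auto
  then show ?thesis by (simp add: det_2)
qed

lemma matrix_mult_2:
  fixes A B :: "int^2^2"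
  shows "(A ** B)$i$j = A$i$1 * B$1$j + A$i$2 * B$2$j"
  by (simp add: matrix_matrix_mult_def UNIV_2)

lemma moebius_mult:
  assumes "invertible B"
  shows "moebius (A ** B) p = moebius A (moebius B p)"
proof -
  define e f g h :: rat where "e = of_int (B$1$1)" and "f = of_int (B$1$2)"
    and "g = of_int (B$2$1)" and "h = of_int (B$2$2)"
  note B = this
  define a b c d :: rat where "a = of_int (A$1$1)" and "b = of_int (A$1$2)"
    and "c = of_int (A$2$1)" and "d = of_int (A$2$2)"
  note A = this
  have "e * h - f * g = of_int (B$1$1 * B$2$2 - B$1$2 * B$2$1)"
    by (simp add: B)
  also have "\<dots> \<noteq> 0"
    unfolding of_int_eq_0_iff using invertible_det_2[OF assms] by force
  finally have det: "e * h - f * g \<noteq> 0" .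
  have mA: "moebius A q = (case q of None \<Rightarrow> if c = 0 then None else Some (a / c)
     | Some x \<Rightarrow> if c * x + d = 0 then None else Some ((a * x + b) / (c * x + d)))" for q
    unfolding moebius_def Let_def A ..
  have mB: "moebius B q = (case q of None \<Rightarrow> if g = 0 then None else Some (e / g)
     | Some x \<Rightarrow> if g * x + h = 0 then None else Some ((e * x + f) / (g * x + h)))" for q
    unfolding moebius_def Let_def B ..
  have mAB: "moebius (A ** B) q =
     (case q of None \<Rightarrow> if c * e + d * g = 0 then None else Some ((a * e + b * g) / (c * e + d * g))
     | Some x \<Rightarrow> if (c * e + d * g) * x + (c * f + d * h) = 0 then None
         else Some (((a * e + b * g) * x + (a * f + b * h)) / ((c * e + d * g) * x + (c * f + d * h))))" for q
    unfolding moebius_def Let_def A B matrix_mult_2 of_int_add of_int_mult ..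
  have key: "moebius A (if v = 0 then None else Some (u / v)) =
     (if c * u + d * v = 0 then None else Some ((a * u + b * v) / (c * u + d * v)))"
    if "u \<noteq> 0 \<or> v \<noteq> 0" for u v
  proof (cases "v = 0")
    case False
    then have "c * (u / v) + d = (c * u + d * v) / v" "a * (u / v) + b = (a * u + b * v) / v"
      by (simp_all add: field_simps)
    with False show ?thesis by (simp add: mA)
  qed (use that in \<open>simp add: mA\<close>)
  show ?thesis
  proof (cases p)
    case None
    have "e \<noteq> 0 \<or> g \<noteq> 0" using det by auto
    from key[OF this] show ?thesis by (simp add: None mAB mB)
  next
    case (Some x)
    have "e * x + f \<noteq> 0 \<or> g * x + h \<noteq> 0"
    proof (rule ccontr)
      assume "\<not> ?thesis"
      then have "f = - (e * x)" "h = - (g * x)" by (simp_all add: eq_neg_iff_add_eq_0 add.commute)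
      with det show False by simp
    qed
    from key[OF this] show ?thesis
      by (simp add: Some mAB mB) (simp add: algebra_simps)
  qed
qed

lemma moebius_one: "moebius (mat 1) p = p"
  by (cases p) (simp_all add: moebius_def mat_def)

lemma group_action_PGL2Z: "group_action PGL2Z UNIV pgl_action"
proof -
  have bij: "bij (moebius A)" if A: "invertible A" for A
  proof -
    obtain B where B: "A ** B = mat 1" "B ** A = mat 1"
      using A by (auto simp: invertible_def)
    then have "invertible B" by (auto simp: invertible_def)
    show ?thesis
    proof (rule o_bij)
      show "moebius B \<circ> moebius A = id"
        using moebius_mult[OF A, of B] B by (auto simp: moebius_one)
      show "moebius A \<circ> moebius B = id"
        using moebius_mult[OF \<open>invertible B\<close>, of A] B by (auto simp: moebius_one)
    qed
  qed
  have act: "pgl_action (pm A) = moebius A" for A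
    by (rule ext) (rule pgl_action_pm)
  have "pgl_action \<in> hom PGL2Z (BijGroup UNIV)"
    by (rule homI)
      (auto simp: carrier_PGL2Z BijGroup_def Bij_def act bij mult_PGL2Z moebius_mult compose_def)
  then show ?thesis
    by (simp add: group_action_def group_hom_def group_hom_axioms_def group_PGL2Z group_BijGroup)
qed

lemma matrix_eq_2:
  fixes A :: "int^2^2"
  shows "A = vector [vector [a, b], vector [c, d]] \<longleftrightarrow>
    A$1$1 = a \<and> A$1$2 = b \<and> A$2$1 = c \<and> A$2$2 = d"
  by (auto simp: vec_eq_iff forall_2)

lemma invertible_unipotent: "invertible (vector [vector [1, n], vector [0, 1]] :: int^2^2)"
  unfolding invertible_def
  by (rule exI[of _ "vector [vector [1, -n], vector [0, 1]]"])
     (auto simp: vec_eq_iff forall_2 matrix_mult_2 mat_def)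

lemma invertible_nu: "invertible (vector [vector [-1, 0], vector [0, 1]] :: int^2^2)"
  unfolding invertible_def
  by (rule exI[of _ "vector [vector [-1, 0], vector [0, 1]]"])
     (auto simp: vec_eq_iff forall_2 matrix_mult_2 mat_def)

lemma tau_int_pow: "tau [^]\<^bsub>PGL2Z\<^esub> (n::int) = pm (vector [vector [1, n], vector [0, 1]])"
proof -
  interpret Group.group PGL2Z by (rule group_PGL2Z)
  define U :: "int \<Rightarrow> (int^2^2) set" where "U m = pm (vector [vector [1, m], vector [0, 1]])" for m
  have U: "U m \<in> carrier PGL2Z" for m
    by (auto simp: U_def carrier_PGL2Z invertible_unipotent)
  have U0: "U 0 = \<one>\<^bsub>PGL2Z\<^esub>"
    unfolding U_def one_PGL2Z by (rule arg_cong[of _ _ pm]) (auto simp: vec_eq_iff forall_2 mat_def)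
  have add: "U k \<otimes>\<^bsub>PGL2Z\<^esub> U m = U (k + m)" for k m
    unfolding U_def mult_PGL2Z
    by (rule arg_cong[of _ _ pm]) (auto simp: vec_eq_iff forall_2 matrix_mult_2)
  have nat: "U 1 [^]\<^bsub>PGL2Z\<^esub> (m::nat) = U (int m)" for m
    by (induction m) (simp_all add: U0 add add.commute)
  have inv: "inv\<^bsub>PGL2Z\<^esub> (U m) = U (- m)" for m
    by (rule inv_equality) (simp_all add: add U U0)
  have "U 1 [^]\<^bsub>PGL2Z\<^esub> n = U n"
    by (cases "n \<ge> 0") (simp_all add: int_pow_def2 nat inv)
  then show ?thesis by (simp add: U_def tau_def)
qed

lemma T_hat_eq_stabilizer: "T_hat = pgl_stabilizer None"
proof -
  interpret Group.group PGL2Z by (rule group_PGL2Z)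
  have nu: "nu \<in> carrier PGL2Z"
    by (auto simp: nu_def carrier_PGL2Z invertible_nu)
  have e0: "tau [^]\<^bsub>PGL2Z\<^esub> (n::int) \<otimes>\<^bsub>PGL2Z\<^esub> nu [^]\<^bsub>PGL2Z\<^esub> (0::nat)
      = pm (vector [vector [1, n], vector [0, 1]])" for n
    by (simp add: tau_int_pow carrier_PGL2Z invertible_unipotent)
  have e1: "tau [^]\<^bsub>PGL2Z\<^esub> (n::int) \<otimes>\<^bsub>PGL2Z\<^esub> nu [^]\<^bsub>PGL2Z\<^esub> (1::nat)
      = pm (vector [vector [-1, n], vector [0, 1]])" for n
  proof -
    have nu1: "nu [^]\<^bsub>PGL2Z\<^esub> (1::nat) = nu" using nu by simp
    show ?thesis
      unfolding tau_int_pow nu1 unfolding nu_def mult_PGL2Z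
      by (rule arg_cong[of _ _ pm]) (auto simp: vec_eq_iff forall_2 matrix_mult_2)
  qed
  have T: "T_hat = {pm (vector [vector [s, n], vector [0, 1]]) | s n. s \<in> {1, -1}}"
  proof -
    have "T_hat = {X. (\<exists>n::int. X = tau [^]\<^bsub>PGL2Z\<^esub> n \<otimes>\<^bsub>PGL2Z\<^esub> nu [^]\<^bsub>PGL2Z\<^esub> (0::nat)) \<or>
        (\<exists>n::int. X = tau [^]\<^bsub>PGL2Z\<^esub> n \<otimes>\<^bsub>PGL2Z\<^esub> nu [^]\<^bsub>PGL2Z\<^esub> (1::nat))}"
      unfolding T_hat_def by blast
    then show ?thesis unfolding e0 e1 by blast
  qed
  show ?thesis
  proof
    have "invertible (vector [vector [-1, n], vector [0, 1]] :: int^2^2)" for n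
      unfolding invertible_def
      by (rule exI[of _ "vector [vector [-1, n], vector [0, 1]]"])
         (auto simp: vec_eq_iff forall_2 matrix_mult_2 mat_def)
    then show "T_hat \<subseteq> pgl_stabilizer None"
      unfolding T stabilizer_def
      by (auto simp: carrier_PGL2Z pgl_action_pm moebius_def invertible_unipotent)
  next
    show "pgl_stabilizer None \<subseteq> T_hat"
    proof
      fix X assume "X \<in> pgl_stabilizer None"
      then obtain A where A: "invertible A" "X = pm A" "moebius A None = None"
        by (auto simp: stabilizer_def carrier_PGL2Z pgl_action_pm)
      then have c: "A$2$1 = 0" by (auto simp: moebius_def split: if_splits)
      with invertible_det_2[OF A(1)] have "A$1$1 * A$2$2 \<in> {1, -1}" by simp
      then have d: "A$1$1 \<in> {1, -1}" "A$2$2 \<in> {1, -1}"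
        by (auto simp: zmult_eq_1_iff zmult_eq_neg1_iff)
      have X: "X = pm (- A)" using A by (auto simp: pm_def)
      show "X \<in> T_hat"
      proof (cases "A$2$2 = 1")
        case True
        then have "A = vector [vector [A$1$1, A$1$2], vector [0, 1]]"
          by (subst matrix_eq_2) (simp add: c)
        then have "X = pm (vector [vector [A$1$1, A$1$2], vector [0, 1]])"
          using A(2) by simp
        with d(1) show ?thesis unfolding T by blast
      next
        case False
        then have "- A = vector [vector [- A$1$1, - A$1$2], vector [0, 1]]"
          using d by (subst matrix_eq_2) (auto simp: c)
        moreover have "- A$1$1 \<in> {1, -1}" using d by auto
        moreover from calculation(1) have "X = pm (vector [vector [- A$1$1, - A$1$2], vector [0, 1]])"
          using X by simp
        ultimately show ?thesis unfolding T by blast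
      qed
    qed
  qed
qed

end

theory Submission
  imports Defs
begin

text \<open>A Neumann subgroup \<open>S\<close> meets every coset of the stabilizer of \<open>\<infinity>\<close> exactly once, and
  \<open>PGL(2,\<int>)\<close> is transitive on \<open>\<rat> \<union> {\<infinity>}\<close>, so \<open>S\<close> acts regularly there; in particular it has
  trivial point stabilizers. If \<open>S \<subseteq> S'\<close> with \<open>S'\<close> anisotropic and \<open>s t \<in> S'\<close> with \<open>s \<in> S\<close> and
  \<open>t\<close> fixing \<open>\<infinity>\<close>, then \<open>t \<in> S'\<close>, whence \<open>t = 1\<close>.\<close>

text \<open>The first column of a matrix gives the image of \<infinity>; a coprime pair is completed
  to a matrix of determinant 1 by Bezout.\<close>

lemma ex_moebius_infinity_eq: "\<exists>A. invertible A \<and> moebius A None = p"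
proof (cases p)
  case None
  then show ?thesis
    using group.is_monoid[OF group_GL2Z, THEN monoid.one_closed] moebius_one by auto
next
  case (Some x)
  obtain a c where q: "quotient_of x = (a, c)"
    by (cases "quotient_of x")
  then have c: "c > 0" and cop: "coprime a c" and x: "x = of_int a / of_int c"
    by (simp_all add: quotient_of_denom_pos quotient_of_coprime quotient_of_div)
  obtain u v where uv: "u * a + v * c = 1"
    using bezout_int[of a c] cop by auto
  \<comment> \<open>The Bezout relation \<open>u * a + v * c = 1\<close> is the determinant of
    \<open>A\<close>, so its adjugate \<open>B\<close> is its inverse.\<close>
  define A :: "int^2^2" where "A = vector [vector [a, - v], vector [c, u]]"
  define B :: "int^2^2" where "B = vector [vector [u, v], vector [- c, a]]"
  have "A ** B = mat 1" "B ** A = mat 1"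
    using uv by (auto simp: A_def B_def vec_eq_iff forall_2 matrix_mult_2 mat_def algebra_simps)
  then have "invertible A"
    by (auto simp: invertible_def)
  moreover have "moebius A None = p"
    using c by (simp add: A_def moebius_def Some x)
  ultimately show ?thesis by blast
qed

lemma pgl_transitive: "\<exists>g \<in> carrier PGL2Z. pgl_action g None = p"
proof -
  obtain A where "invertible A" "moebius A None = p"
    using ex_moebius_infinity_eq by blast
  then show ?thesis
    by (intro bexI[of _ "pm A"]) (auto simp: pgl_action_pm carrier_PGL2Z)
qed

text \<open>In a factorization \<open>g = s t\<close> the factor \<open>t\<close> from
  \<open>T_hat\<close> fixes \<infinity>, so \<open>s\<close> moves \<infinity> to the same point as
  \<open>g\<close>.\<close>

lemma neumann_transitive:
  assumes "neumann_subgroup S"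
  shows "\<exists>s \<in> S. pgl_action s None = p"
proof -
  interpret group_action PGL2Z UNIV pgl_action by (rule group_action_PGL2Z)
  obtain g where g: "g \<in> carrier PGL2Z" "pgl_action g None = p"
    using pgl_transitive by blast
  then have "g \<in> S <#>\<^bsub>PGL2Z\<^esub> pgl_stabilizer None"
    using assms by (simp add: neumann_subgroup_def T_hat_eq_stabilizer)
  then obtain s t where st: "s \<in> S" "t \<in> pgl_stabilizer None" "g = s \<otimes>\<^bsub>PGL2Z\<^esub> t"
    by (auto simp: set_mult_def)
  have "s \<in> carrier PGL2Z"
    using assms st(1) by (auto simp: neumann_subgroup_def dest: subgroup.mem_carrier)
  with st g(2) have "pgl_action s None = p"
    by (auto simp: stabilizer_def composition_rule)
  with st(1) show ?thesis by blast
qed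

text \<open>By transitivity of \<open>S\<close>, an element of \<open>S\<close> fixing
  \<open>p\<close> is conjugate within \<open>S\<close> to one fixing \<infinity>, and
  \<open>S\<close> meets \<open>T_hat\<close> trivially.\<close>

lemma neumann_imp_anisotropy:
  assumes S: "neumann_subgroup S"
  shows "anisotropy_subgroup S"
  unfolding anisotropy_subgroup_def isotropy_subgroup_def
proof (intro conjI allI impI ballI)
  show sub: "subgroup S PGL2Z"
    using S by (simp add: neumann_subgroup_def)
  interpret group_action PGL2Z UNIV pgl_action by (rule group_action_PGL2Z)
  interpret Group.group PGL2Z by (rule group_PGL2Z)
  fix H g assume "\<exists>p. H = pgl_stabilizer p" and g: "g \<in> S \<inter> H"
  then obtain p where p: "g \<in> pgl_stabilizer p" by auto
  obtain s where s: "s \<in> S" "pgl_action s None = p"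
    using neumann_transitive[OF S] by blast
  have carr: "s \<in> carrier PGL2Z" "g \<in> carrier PGL2Z"
    using sub s(1) g by (auto dest: subgroup.mem_carrier)
  \<comment> \<open>Under \<open>h\<close>, the point \<infinity> goes to \<open>p\<close> by
    \<open>s\<close>, stays there under \<open>g\<close>, and returns by the inverse of
    \<open>s\<close>.\<close>
  define h where "h = inv\<^bsub>PGL2Z\<^esub> s \<otimes>\<^bsub>PGL2Z\<^esub> (g \<otimes>\<^bsub>PGL2Z\<^esub> s)"
  have "h \<in> S"
    unfolding h_def using sub s(1) g by (auto intro!: subgroup.m_closed subgroup.m_inv_closed)
  moreover have "pgl_action h None = None"
    using carr s p orbit_sym_aux[OF carr(1) _ s(2)]
    by (simp add: h_def composition_rule stabilizer_def)
  then have "h \<in> T_hat"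
    using carr by (simp add: T_hat_eq_stabilizer stabilizer_def h_def)
  ultimately have "h = \<one>\<^bsub>PGL2Z\<^esub>"
    using S by (auto simp: neumann_subgroup_def)
  then have "g \<otimes>\<^bsub>PGL2Z\<^esub> s = s"
    using carr inv_solve_left[of "\<one>\<^bsub>PGL2Z\<^esub>" s "g \<otimes>\<^bsub>PGL2Z\<^esub> s"] by (simp add: h_def)
  then show "g = \<one>\<^bsub>PGL2Z\<^esub>"
    using carr by simp
qed

theorem proposition3:
  fixes S :: "(int^2^2) set set"
  assumes "neumann_subgroup S"
  shows "maximal_anisotropy_subgroup S"
  unfolding maximal_anisotropy_subgroup_def
proof (intro conjI notI)
  show "anisotropy_subgroup S"
    using assms by (rule neumann_imp_anisotropy)
next
  interpret Group.group PGL2Z by (rule group_PGL2Z)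
  assume "\<exists>S'. anisotropy_subgroup S' \<and> S \<subset> S'"
  then obtain S' g where S': "anisotropy_subgroup S'" "S \<subseteq> S'" and g: "g \<in> S'" "g \<notin> S"
    by blast
  have sub: "subgroup S PGL2Z" and sub': "subgroup S' PGL2Z"
    using assms S'(1) by (auto simp: neumann_subgroup_def anisotropy_subgroup_def)
  have "g \<in> S <#>\<^bsub>PGL2Z\<^esub> T_hat"
    using assms subgroup.mem_carrier[OF sub' g(1)] by (simp add: neumann_subgroup_def)
  then obtain s t where st: "s \<in> S" "t \<in> T_hat" "g = s \<otimes>\<^bsub>PGL2Z\<^esub> t"
    by (auto simp: set_mult_def)
  have carr: "s \<in> carrier PGL2Z" "t \<in> carrier PGL2Z"
    using st subgroup.mem_carrier[OF sub] by (auto simp: T_hat_eq_stabilizer stabilizer_def)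
  have "t = inv\<^bsub>PGL2Z\<^esub> s \<otimes>\<^bsub>PGL2Z\<^esub> g"
    using carr st(3) inv_solve_left by simp
  then have "t \<in> S'"
    using sub' S'(2) st(1) g(1) by (auto intro!: subgroup.m_closed subgroup.m_inv_closed)
  \<comment> \<open>\<open>T_hat\<close> is itself an isotropy subgroup, namely that of \<infinity>,
    so anisotropy of \<open>S'\<close> applies to \<open>t\<close>.\<close>
  with st(2) S'(1) have "t = \<one>\<^bsub>PGL2Z\<^esub>"
    by (auto simp: anisotropy_subgroup_def isotropy_subgroup_def T_hat_eq_stabilizer)
  \<comment> \<open>Now \<open>g = s\<close> lies in \<open>S\<close>, against the choice of
    \<open>g\<close>.\<close>
  then show False
    using st carr g(2) by simp
qed

end
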